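(* Let $1\le p<+\infty$ and let $\sigma_\ell(x)=(1+e^{-x})^{-1}$ be the logistic function. Let $I=[a_1,b_1]\times[a_2,b_2]$ be decomposed as $I=\bigcup_{i=0}^{q_1-1}\bigcup_{j=0}^{q_2-1}R_{ij}$, where $a_1=l_0<l_1<\dots<l_{q_1}=b_1$, $a_2=t_0<t_1<\dots<t_{q_2}=b_2$, and $R_{ij}$ is the product of the $i$-th interval $[l_i,l_{i+1})$ (closed on the right if $i=q_1-1$) and the $j$-th interval $[t_j,t_{j+1})$ (closed on the right if $j=q_2-1$). Let $f:I\to\mathbb{R}$ be a bounded function with $f\in C^1(R_{ij}^\circ)$ for all $i,j$, and suppose there are constants $M_f,\beta_f>0$ with $$M_f\ge\left|\frac{\partial f}{\partial x_m}(\mathtt{x})\right|^p\ge\beta_f>0,\qquad \mathtt{x}\in R_{ij}^\circ,\ m=1,2,\ i=0,\dots,q_1-1,\ j=0,\dots,q_2-1 .$$ Let $0<\theta<1$. Then there are suitable constants $K_1,K_2>0$, independent of $n$ and $f$, such that for $n\in\mathbb{N}^+$ $$\|F_n^{\sigma_\ell}(f,\cdot)-f(\cdot)\|_p\le(2^{p-1}q_1q_2)^{1/p}\left(\frac{M_f^{1/p}}{\beta_f^{1/p}}\frac{K_1}{n}\|f\|_{1,p}+8^{1/p}\frac{\|f\|_\infty}{n^{\theta/p}}+K_2\|f\|_\infty\,e^{-n^{(1-\theta)}/p}\right).$$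
   Context: Functions on $I\subset\mathbb{R}^2$ and their partial derivatives are regarded as extended to $\mathbb{R}^2$ by periodicity in each variable. $A^\circ$ denotes the interior of $A$, and $\mathbb{N}^+$ the set of positive integers. Set $\phi_{\sigma_\ell}(x)=\frac12[\sigma_\ell(x+1)-\sigma_\ell(x-1)]$, $\Psi_{\sigma_\ell}(\mathtt{x})=\phi_{\sigma_\ell}(x_1)\phi_{\sigma_\ell}(x_2)$ for $\mathtt{x}=(x_1,x_2)\in\mathbb{R}^2$, and $\mathcal{A}_n=\{\mathtt{k}\in\mathbb{Z}^2:\lceil na_i\rceil\le k_i\le\lfloor nb_i\rfloor,\ i=1,2\}$. The neural network operators activated by $\sigma_\ell$ are $$F_n^{\sigma_\ell}(f,\mathtt{x})=\frac{\sum_{\mathtt{k}\in\mathcal{A}_n}f(\mathtt{k}/n)\,\Psi_{\sigma_\ell}(n\mathtt{x}-\mathtt{k})}{\sum_{\mathtt{k}\in\mathcal{A}_n}\Psi_{\sigma_\ell}(n\mathtt{x}-\mathtt{k})},\qquad \mathtt{x}\in I,\ \mathtt{k}/n=(k_1/n,k_2/n).$$ $\|\cdot\|_p$ is the $L^p(I)$-norm with respect to Lebesgue measure, $\|f\|_\infty=\sup_I|f|$, and $\|f\|_{1,p}=\|f\|_p+\sum_{m=1}^2\|\partial f/\partial x_m\|_p$, where the partial derivatives are the classical ones, defined almost everywhere on $I$ (in the interiors $R_{ij}^\circ$). *)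

theory Defs
  imports "HOL-Analysis.Analysis"
begin

definition logistic :: "real \<Rightarrow> real" where
  "logistic x = inverse (1 + exp (- x))"

definition phi :: "(real \<Rightarrow> real) \<Rightarrow> real \<Rightarrow> real" where
  "phi \<sigma> x = (\<sigma> (x + 1) - \<sigma> (x - 1)) / 2"

definition Psi :: "(real \<Rightarrow> real) \<Rightarrow> real ^ 2 \<Rightarrow> real" where
  "Psi \<sigma> x = phi \<sigma> (x $ 1) * phi \<sigma> (x $ 2)"

definition node_indices :: "real ^ 2 \<Rightarrow> real ^ 2 \<Rightarrow> nat \<Rightarrow> (int ^ 2) set" where
  "node_indices a b n =
     {k. \<forall>i. \<lceil>real n * a $ i\<rceil> \<le> k $ i \<and> k $ i \<le> \<lfloor>real n * b $ i\<rfloor>}"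

text \<open>The operator on the rectangle \<open>cbox a b\<close>. All sample points lie in \<open>cbox a b\<close>, so only the
  values of \<open>f\<close> there matter and no periodic extension of \<open>f\<close> is involved. If \<open>n\<close> is so small that
  there are no sample points, the quotient \<open>0 / 0\<close> evaluates to \<open>0\<close>.\<close>

definition nn_operator ::
    "(real \<Rightarrow> real) \<Rightarrow> real ^ 2 \<Rightarrow> real ^ 2 \<Rightarrow> nat \<Rightarrow> (real ^ 2 \<Rightarrow> real) \<Rightarrow> real ^ 2 \<Rightarrow> real" where
  "nn_operator \<sigma> a b n f x =
     (\<Sum>k\<in>node_indices a b n.
        f (\<chi> i. real_of_int (k $ i) / real n) * Psi \<sigma> (\<chi> i. real n * x $ i - real_of_int (k $ i))) /
     (\<Sum>k\<in>node_indices a b n.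
        Psi \<sigma> (\<chi> i. real n * x $ i - real_of_int (k $ i)))"

definition is_subdivision :: "nat \<Rightarrow> (nat \<Rightarrow> real) \<Rightarrow> real \<Rightarrow> real \<Rightarrow> bool" where
  "is_subdivision q l a b \<longleftrightarrow>
     0 < q \<and> l 0 = a \<and> l q = b \<and> (\<forall>i<q. l i < l (Suc i))"

definition subdivision_interval :: "nat \<Rightarrow> (nat \<Rightarrow> real) \<Rightarrow> nat \<Rightarrow> real set" where
  "subdivision_interval q l i =
     (if i = q - 1 then {l i..l (Suc i)} else {l i..<l (Suc i)})"

definition cell ::
    "nat \<Rightarrow> (nat \<Rightarrow> real) \<Rightarrow> nat \<Rightarrow> (nat \<Rightarrow> real) \<Rightarrow> nat \<Rightarrow> nat \<Rightarrow> (real ^ 2) set" where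
  "cell q1 l q2 t i j =
     {x. x $ 1 \<in> subdivision_interval q1 l i \<and> x $ 2 \<in> subdivision_interval q2 t j}"

definition partial_deriv :: "2 \<Rightarrow> (real ^ 2 \<Rightarrow> real) \<Rightarrow> real ^ 2 \<Rightarrow> real" where
  "partial_deriv m f x = deriv (\<lambda>s. f (x + s *\<^sub>R axis m 1)) 0"

text \<open>Intended for open \<open>S\<close> only.\<close>

definition C1_on :: "(real ^ 2) set \<Rightarrow> (real ^ 2 \<Rightarrow> real) \<Rightarrow> bool" where
  "C1_on S f \<longleftrightarrow>
     (\<forall>m. (\<forall>x\<in>S. (\<lambda>s. f (x + s *\<^sub>R axis m 1)) differentiable (at 0)) \<and>
          continuous_on S (partial_deriv m f))"

text \<open>With \<open>lebesgue\<close> instead of \<open>lborel\<close>, a function that is continuous on the interiors of finitely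
  many cells covering \<open>S\<close> is measurable on \<open>S\<close> whatever its values on the cell boundaries.\<close>

definition Lp_norm :: "real \<Rightarrow> (real ^ 2) set \<Rightarrow> (real ^ 2 \<Rightarrow> real) \<Rightarrow> real" where
  "Lp_norm p S f = (LINT x:S|lebesgue. \<bar>f x\<bar> powr p) powr (1 / p)"

definition sup_norm :: "(real ^ 2) set \<Rightarrow> (real ^ 2 \<Rightarrow> real) \<Rightarrow> real" where
  "sup_norm S f = (SUP x\<in>S. \<bar>f x\<bar>)"

text \<open>If \<open>f\<close> is only piecewise continuously differentiable, \<open>partial_deriv\<close> takes unspecified values
  at the cell boundaries. These form a null set and do not affect the integral.\<close>

definition W1p_norm :: "real \<Rightarrow> (real ^ 2) set \<Rightarrow> (real ^ 2 \<Rightarrow> real) \<Rightarrow> real" where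
  "W1p_norm p S f = Lp_norm p S f + (\<Sum>m\<in>UNIV. Lp_norm p S (partial_deriv m f))"

end

theory Submission
  imports Defs "HOL-Real_Asymp.Real_Asymp"
begin

text \<open>
  The operator averages the samples \<open>f (k / n)\<close> with weights that decay exponentially in
  \<open>\<bar>n x - k\<bar>\<close>, so a node at distance \<open>d\<close> from \<open>x\<close> has weight at most of order \<open>exp (- n d)\<close>. Write \<open>F\<close> for the
  supremum of \<open>\<bar>f\<bar>\<close> and \<open>L = M powr (1 / p)\<close>, fix an exponent \<open>\<eta>\<close> with \<open>\<theta> < \<eta> < 1\<close>, and let
  \<open>\<delta> = n powr (- \<eta>)\<close>.

  The points within \<open>\<delta>\<close> of a grid line form a set of measure \<open>O(\<delta>)\<close> (\<open>grid_neighbourhood\<close>). The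
  error there is at most \<open>2 F\<close>, which contributes \<open>O(F n powr (- \<eta> / p))\<close> to the norm. If \<open>x\<close> is
  farther from the grid, all nodes within \<open>\<delta>\<close> of \<open>x\<close> lie in its own open cell. By the mean value
  theorem along the axes \<open>f\<close> is Lipschitz there with constant \<open>L\<close> (\<open>lipschitz_on_open_cell\<close>), and since
  the mean distance of the nodes is \<open>O(1 / n)\<close>, these nodes contribute \<open>O(L / n)\<close>. The remaining nodes
  carry a total weight \<open>O(exp (- n \<delta> / 2))\<close>. Both parts are in \<open>nn_operator_error_off_grid\<close>.

  The lower bound on the derivatives turns \<open>L\<close> into the norm of \<open>f\<close>: it gives
  \<open>\<beta> powr (1 / p) * area powr (1 / p) \<le> W1p_norm\<close> (\<open>W1p_norm_ge\<close>), so that \<open>L\<close> times the root of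
  the area is at most \<open>M powr (1 / p) / \<beta> powr (1 / p)\<close> times that norm. The two terms with \<open>F\<close> are
  of smaller order than \<open>n powr (- \<theta> / p)\<close>, so from some \<open>N\<close> on they are below
  \<open>8 powr (1 / p) * F / n powr (\<theta> / p)\<close> (\<open>eventually_remainder_le\<close>). Here \<open>N\<close> depends only on \<open>p\<close>,
  \<open>\<theta>\<close> and the grid. For \<open>n < N\<close> the error is at most \<open>2 F\<close>, and \<open>K2\<close> is chosen so large that the
  exponential term alone covers it.
\<close>

section \<open>The logistic kernel\<close>

lemma phi_logistic_pos: "0 < phi logistic u"
proof -
  have "inverse (1 + exp (- (u - 1))) < inverse (1 + exp (- (u + 1)))"
    by (intro less_imp_inverse_less) (auto intro: add_pos_pos)
  then show ?thesis
    by (simp add: phi_def logistic_def)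
qed

text \<open>For \<open>u \<ge> 0\<close> the tail \<open>1 - logistic (u - 1)\<close> dominates the difference
  \<open>logistic (u + 1) - logistic (u - 1)\<close>, and for \<open>u < 0\<close> the tail \<open>logistic (u + 1)\<close> does; both tails
  of the logistic function are at most exponential.\<close>

lemma phi_logistic_le: "phi logistic u \<le> exp (1 - \<bar>u\<bar>)"
proof -
  have upper: "logistic v \<le> 1" and lower: "0 \<le> logistic v" and left: "logistic v \<le> exp v"
    and right: "1 - logistic v \<le> exp (- v)" for v
  proof -
    have "0 < 1 + exp (- v)"
      by (simp add: add_pos_pos)
    moreover have "exp v * exp (- v) = 1"
      by (simp flip: exp_add)
    ultimately show "logistic v \<le> 1" "0 \<le> logistic v" "logistic v \<le> exp v" "1 - logistic v \<le> exp (- v)"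
      by (auto simp: logistic_def field_simps)
  qed
  have "2 * phi logistic u \<le> exp (1 - \<bar>u\<bar>)"
  proof (cases "0 \<le> u")
    case True
    then show ?thesis
      using upper[of "u + 1"] right[of "u - 1"] by (simp add: phi_def)
  next
    case False
    then show ?thesis
      using lower[of "u - 1"] left[of "u + 1"] by (simp add: phi_def add.commute)
  qed
  then show ?thesis
    using phi_logistic_pos[of u] by linarith
qed

text \<open>A node within one grid step of \<open>x\<close> has a weight bounded from below, which keeps the denominator
  of the operator away from zero uniformly in \<open>x\<close> and \<open>n\<close>.\<close>

lemma phi_logistic_bounded_below: "\<exists>c>0. \<forall>u. \<bar>u\<bar> \<le> 1 \<longrightarrow> c \<le> phi logistic u"
proof -
  have "1 + exp v \<noteq> 0" for v :: real
    using exp_gt_zero[of v] by linarith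
  then have "continuous_on {-1..1} (phi logistic)"
    unfolding phi_def[abs_def] logistic_def by (intro continuous_intros) auto
  then obtain v where "\<forall>u\<in>{-1..1}. phi logistic v \<le> phi logistic u"
    using continuous_attains_inf[of "{-1..1::real}" "phi logistic"] by auto
  then show ?thesis
    using phi_logistic_pos by (intro exI[of _ "phi logistic v"]) (auto simp: abs_le_iff)
qed

text \<open>Measuring the distances from \<open>\<lfloor>u\<rfloor>\<close> instead of \<open>u\<close> costs the factor \<open>exp (1/2)\<close> and leaves one
  geometric series on each side of \<open>\<lfloor>u\<rfloor>\<close>; the bound thus depends neither on \<open>u\<close> nor on \<open>K\<close>.\<close>

lemma sum_exp_dist_int_le:
  fixes u :: real
  assumes "finite K"
  shows "(\<Sum>k\<in>K. exp (- \<bar>u - of_int k\<bar> / 2)) \<le> 2 * exp (1/2) / (1 - exp (- 1/2))"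
proof -
  define r :: real where "r = exp (- 1/2)"
  have r: "0 \<le> r" "r < 1"
    by (simp_all add: r_def)
  have pow: "r ^ j = exp (- real j / 2)" for j
    by (simp add: r_def flip: exp_of_nat_mult)
  have geom: "(\<Sum>j\<in>J. r ^ j) \<le> 1 / (1 - r)" if "finite J" for J
    using sum_le_suminf[OF summable_geometric that, of r] r suminf_geometric[of r] by simp
  define m where "m = \<lfloor>u\<rfloor>"
  have m: "of_int m \<le> u" "u < of_int m + 1"
    unfolding m_def by linarith+
  have term_le: "exp (- \<bar>u - of_int k\<bar> / 2) \<le> exp (1/2) * r ^ nat \<bar>k - m\<bar>" for k
  proof -
    have "\<bar>real_of_int k - real_of_int m\<bar> \<le> \<bar>u - of_int k\<bar> + 1"
      using m by linarith
    then have "- \<bar>u - of_int k\<bar> / 2 \<le> 1 / 2 - real (nat \<bar>k - m\<bar>) / 2"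
      by (simp add: field_simps)
    then show ?thesis
      by (simp add: pow flip: exp_add)
  qed
  have half: "(\<Sum>k\<in>K'. r ^ nat \<bar>k - m\<bar>) \<le> 1 / (1 - r)"
    if "finite K'" "inj_on (\<lambda>k. nat \<bar>k - m\<bar>) K'" for K'
    using geom[of "(\<lambda>k. nat \<bar>k - m\<bar>) ` K'"] that by (simp add: sum.reindex)
  have "(\<Sum>k\<in>K. r ^ nat \<bar>k - m\<bar>)
      = (\<Sum>k\<in>{k\<in>K. m \<le> k}. r ^ nat \<bar>k - m\<bar>) + (\<Sum>k\<in>{k\<in>K. \<not> m \<le> k}. r ^ nat \<bar>k - m\<bar>)"
    using assms by (subst sum.union_disjoint [symmetric]) (auto intro: sum.cong)
  also have "\<dots> \<le> 1 / (1 - r) + 1 / (1 - r)"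
    using assms by (intro add_mono half) (auto simp: inj_on_def)
  finally have "(\<Sum>k\<in>K. r ^ nat \<bar>k - m\<bar>) \<le> 2 / (1 - r)"
    by simp
  then have "exp (1/2) * (\<Sum>k\<in>K. r ^ nat \<bar>k - m\<bar>) \<le> exp (1/2) * (2 / (1 - r))"
    by (intro mult_left_mono) auto
  moreover have "(\<Sum>k\<in>K. exp (- \<bar>u - of_int k\<bar> / 2)) \<le> exp (1/2) * (\<Sum>k\<in>K. r ^ nat \<bar>k - m\<bar>)"
    unfolding sum_distrib_left by (intro sum_mono term_le)
  ultimately show ?thesis
    by (simp add: r_def mult.commute)
qed

section \<open>Sums over the nodes\<close>

lemma sum_node_indices:
  fixes g h :: "int \<Rightarrow> real"
  shows "(\<Sum>k\<in>node_indices a b n. g (k $ 1) * h (k $ 2)) =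
    (\<Sum>i\<in>{\<lceil>real n * a $ 1\<rceil>..\<lfloor>real n * b $ 1\<rfloor>}. g i) * (\<Sum>j\<in>{\<lceil>real n * a $ 2\<rceil>..\<lfloor>real n * b $ 2\<rfloor>}. h j)"
  unfolding sum_product sum.cartesian_product
  by (rule sum.reindex_bij_witness[where j = "\<lambda>k. (k $ 1, k $ 2)" and i = "\<lambda>(i, j). vector [i, j]"])
    (auto simp: node_indices_def forall_2 vec_eq_iff)

lemma finite_node_indices: "finite (node_indices a b n)"
proof (rule finite_imageD)
  show "finite ((\<lambda>k. (k $ 1, k $ 2)) ` node_indices a b n)"
    by (rule finite_subset[of _ "{\<lceil>real n * a $ 1\<rceil>..\<lfloor>real n * b $ 1\<rfloor>} \<times> {\<lceil>real n * a $ 2\<rceil>..\<lfloor>real n * b $ 2\<rfloor>}"])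
      (auto simp: node_indices_def)
  show "inj_on (\<lambda>k. (k $ 1, k $ 2)) (node_indices a b n)"
    by (auto simp: inj_on_def vec_eq_iff forall_2)
qed

lemma node_in_cbox:
  fixes k :: "int ^ 2"
  assumes "0 < n" "k \<in> node_indices a b n"
  shows "(\<chi> i. real_of_int (k $ i) / real n) \<in> cbox a b"
proof -
  have "real n * a $ i \<le> real_of_int (k $ i) \<and> real_of_int (k $ i) \<le> real n * b $ i" for i
    using assms(2) unfolding node_indices_def by (auto simp: ceiling_le_iff le_floor_iff)
  then show ?thesis
    using assms(1) by (auto simp: mem_box_cart field_simps)
qed

definition node_dist :: "nat \<Rightarrow> real ^ 2 \<Rightarrow> int ^ 2 \<Rightarrow> real" where
  "node_dist n x k = \<bar>real n * x $ 1 - real_of_int (k $ 1)\<bar> + \<bar>real n * x $ 2 - real_of_int (k $ 2)\<bar>"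

lemma Psi_logistic_pos: "0 < Psi logistic v"
  by (simp add: Psi_def phi_logistic_pos)

lemma Psi_logistic_le:
  "Psi logistic (\<chi> i. real n * x $ i - real_of_int (k $ i)) \<le> exp 2 * exp (- node_dist n x k)"
proof -
  let ?u = "\<lambda>i. real n * x $ i - real_of_int (k $ i)"
  have "phi logistic (?u 1) * phi logistic (?u 2) \<le> exp (1 - \<bar>?u 1\<bar>) * exp (1 - \<bar>?u 2\<bar>)"
    by (intro mult_mono phi_logistic_le) (auto intro: less_imp_le phi_logistic_pos)
  also have "\<dots> = exp 2 * exp (- node_dist n x k)"
    by (simp add: node_dist_def flip: exp_add)
  finally show ?thesis
    by (simp add: Psi_def)
qed

lemma sum_exp_node_dist_le:
  "(\<Sum>k\<in>node_indices a b n. exp (- node_dist n x k / 2)) \<le> (2 * exp (1/2) / (1 - exp (- 1/2)))\<^sup>2"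
proof -
  let ?g = "\<lambda>v i. exp (- \<bar>real n * v - real_of_int i\<bar> / 2)"
  have "exp (- node_dist n x k / 2) = ?g (x $ 1) (k $ 1) * ?g (x $ 2) (k $ 2)" for k
    by (simp add: node_dist_def add_divide_distrib flip: exp_add)
  then show ?thesis
    unfolding power2_eq_square
    by (simp only: sum_node_indices[of "?g (x $ 1)" "?g (x $ 2)"])
      (intro mult_mono sum_exp_dist_int_le, auto intro: sum_nonneg)
qed

section \<open>The error of the operator at a point\<close>

text \<open>One of the two integers around \<open>u\<close> stays in the interval when its length is at least \<open>1\<close>.\<close>

lemma int_near:
  fixes u \<alpha> \<omega> :: real
  assumes "\<alpha> \<le> u" "u \<le> \<omega>" "1 \<le> \<omega> - \<alpha>"
  shows "\<exists>k. \<lceil>\<alpha>\<rceil> \<le> k \<and> k \<le> \<lfloor>\<omega>\<rfloor> \<and> \<bar>u - of_int k\<bar> \<le> 1"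
proof (cases "\<alpha> \<le> of_int \<lfloor>u\<rfloor>")
  case True
  show ?thesis
    by (rule exI[of _ "\<lfloor>u\<rfloor>"]) (use True assms in \<open>auto simp: ceiling_le_iff intro: floor_mono; linarith\<close>)
next
  case False
  show ?thesis
    by (rule exI[of _ "\<lfloor>u\<rfloor> + 1"]) (use False assms in \<open>auto simp: ceiling_le_iff le_floor_iff; linarith\<close>)
qed

text \<open>An average of the samples. If all weights sum to \<open>0\<close> there are no nodes and the quotient
  is \<open>0\<close>, so the bound holds for every positive \<open>n\<close>.\<close>

lemma abs_nn_operator_le:
  assumes "0 < n" and "\<And>y. y \<in> cbox a b \<Longrightarrow> \<bar>f y\<bar> \<le> F" and "0 \<le> F"
  shows "\<bar>nn_operator logistic a b n f x\<bar> \<le> F"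
proof -
  let ?K = "node_indices a b n"
  let ?f = "\<lambda>k :: int ^ 2. f (\<chi> i. real_of_int (k $ i) / real n)"
  let ?w = "\<lambda>k :: int ^ 2. Psi logistic (\<chi> i. real n * x $ i - real_of_int (k $ i))"
  have w: "0 \<le> ?w k" for k
    by (rule less_imp_le) (rule Psi_logistic_pos)
  have "\<bar>\<Sum>k\<in>?K. ?f k * ?w k\<bar> \<le> (\<Sum>k\<in>?K. \<bar>?f k * ?w k\<bar>)"
    by (rule sum_abs)
  also have "\<dots> \<le> (\<Sum>k\<in>?K. F * ?w k)"
    using w assms node_in_cbox by (intro sum_mono) (auto simp: abs_mult intro!: mult_right_mono)
  finally have num: "\<bar>\<Sum>k\<in>?K. ?f k * ?w k\<bar> \<le> F * (\<Sum>k\<in>?K. ?w k)"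
    by (simp add: sum_distrib_left)
  have "0 \<le> (\<Sum>k\<in>?K. ?w k)"
    by (intro sum_nonneg w)
  then show ?thesis
    using num assms(3) unfolding nn_operator_def
    by (cases "(\<Sum>k\<in>?K. ?w k) = 0") (auto simp: divide_simps)
qed

text \<open>Half of the exponential decay of a weight is spent on the error at its node: with \<open>y\<close> the
  node distance, \<open>y * exp (- y / 2)\<close> is at most \<open>2\<close>, and the jump \<open>B\<close>, present only for \<open>y \<ge> z\<close>, is
  damped to \<open>B * exp (- z / 2)\<close>. The other half makes the sum over all nodes bounded. A single
  node within \<open>1 / n\<close> of \<open>x\<close> in each coordinate bounds the denominator from below by \<open>c\<^sup>2\<close>; it
  exists because the rectangle is at least \<open>1 / n\<close> wide in each direction.\<close>

lemma nn_operator_error_le: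
  assumes n: "0 < n" and x: "x \<in> cbox a b" and wide: "\<And>i. 1 \<le> real n * (b $ i - a $ i)"
    and c: "0 < c" "\<And>u. \<bar>u\<bar> \<le> 1 \<Longrightarrow> c \<le> phi logistic u"
    and AB: "0 \<le> A" "0 \<le> B"
    and f: "\<And>k. k \<in> node_indices a b n \<Longrightarrow>
      \<bar>f (\<chi> i. real_of_int (k $ i) / real n) - f x\<bar>
        \<le> A * node_dist n x k + (if node_dist n x k < z then 0 else B)"
  shows "\<bar>nn_operator logistic a b n f x - f x\<bar>
    \<le> exp 2 * (2 * exp (1/2) / (1 - exp (- 1/2)))\<^sup>2 / c\<^sup>2 * (2 * A + B * exp (- z / 2))"
proof -
  let ?K = "node_indices a b n"
  let ?f = "\<lambda>k :: int ^ 2. f (\<chi> i. real_of_int (k $ i) / real n)"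
  let ?w = "\<lambda>k :: int ^ 2. Psi logistic (\<chi> i. real n * x $ i - real_of_int (k $ i))"
  let ?S = "(2 * exp (1/2) / (1 - exp (- 1/2)))\<^sup>2 :: real"
  let ?D = "\<Sum>k\<in>?K. ?w k"
  let ?E = "2 * A + B * exp (- z / 2)"
  have w: "0 \<le> ?w k" for k
    by (rule less_imp_le) (rule Psi_logistic_pos)
  have E: "0 \<le> ?E"
    using AB by simp
  have term_le: "\<bar>?f k - f x\<bar> * ?w k \<le> exp 2 * ?E * exp (- node_dist n x k / 2)"
    if k: "k \<in> ?K" for k
  proof -
    let ?y = "node_dist n x k"
    have y: "0 \<le> ?y"
      by (simp add: node_dist_def)
    have split: "exp (- ?y) = exp (- ?y / 2) * exp (- ?y / 2)"
      by (simp flip: exp_add)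
    have "?y \<le> 2 * exp (?y / 2)"
      using exp_ge_add_one_self[of "?y / 2"] by linarith
    then have "?y * exp (- ?y / 2) \<le> 2 * exp (?y / 2) * exp (- ?y / 2)"
      by (intro mult_right_mono) auto
    also have "\<dots> = 2"
      by (simp add: exp_minus)
    finally have "A * (?y * exp (- ?y / 2)) \<le> A * 2"
      using AB by (intro mult_left_mono)
    moreover have "(if ?y < z then 0 else B) * exp (- ?y / 2) \<le> B * exp (- z / 2)"
      using AB by (auto intro!: mult_left_mono)
    ultimately have "(A * ?y + (if ?y < z then 0 else B)) * exp (- ?y / 2) \<le> ?E"
      by (simp only: distrib_right mult.assoc mult.commute[of A 2])
    then have "exp 2 * exp (- ?y / 2) * ((A * ?y + (if ?y < z then 0 else B)) * exp (- ?y / 2))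
        \<le> exp 2 * exp (- ?y / 2) * ?E"
      by (intro mult_left_mono) auto
    moreover have "\<bar>?f k - f x\<bar> * ?w k \<le> (A * ?y + (if ?y < z then 0 else B)) * (exp 2 * exp (- ?y))"
      using f[OF k] Psi_logistic_le w by (intro mult_mono) auto
    ultimately show ?thesis
      unfolding split by (simp only: mult_ac)
  qed
  have "\<bar>\<Sum>k\<in>?K. (?f k - f x) * ?w k\<bar> \<le> (\<Sum>k\<in>?K. \<bar>(?f k - f x) * ?w k\<bar>)"
    by (rule sum_abs)
  also have "\<dots> \<le> (\<Sum>k\<in>?K. exp 2 * ?E * exp (- node_dist n x k / 2))"
    using term_le w by (intro sum_mono) (simp add: abs_mult)
  also have "\<dots> \<le> exp 2 * ?E * ?S"
    unfolding sum_distrib_left[symmetric] using E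
    by (intro mult_left_mono sum_exp_node_dist_le) auto
  finally have num: "\<bar>\<Sum>k\<in>?K. (?f k - f x) * ?w k\<bar> \<le> exp 2 * ?E * ?S" .
  have "\<exists>m. \<lceil>real n * a $ i\<rceil> \<le> m \<and> m \<le> \<lfloor>real n * b $ i\<rfloor> \<and> \<bar>real n * x $ i - of_int m\<bar> \<le> 1" for i
    using x wide[of i] by (intro int_near) (auto simp: mem_box_cart algebra_simps mult_left_mono)
  then obtain k where k: "\<And>i. \<lceil>real n * a $ i\<rceil> \<le> k i \<and> k i \<le> \<lfloor>real n * b $ i\<rfloor> \<and>
      \<bar>real n * x $ i - of_int (k i)\<bar> \<le> 1"
    by metis
  define k0 where "k0 = (\<chi> i. k i)"
  have k0: "k0 \<in> ?K"
    using k by (simp add: node_indices_def k0_def)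
  have "c\<^sup>2 \<le> ?w k0"
    using k c unfolding Psi_def power2_eq_square k0_def
    by (intro mult_mono) (auto intro: less_imp_le phi_logistic_pos)
  also have "\<dots> \<le> ?D"
    using k0 w by (intro member_le_sum finite_node_indices) auto
  finally have D: "c\<^sup>2 \<le> ?D" .
  have c2: "0 < c\<^sup>2"
    using c by simp
  have D_nonzero: "?D \<noteq> 0" and D_abs: "\<bar>?D\<bar> = ?D"
    using D c2 by linarith+
  have "nn_operator logistic a b n f x - f x = (\<Sum>k\<in>?K. (?f k - f x) * ?w k) / ?D"
    using D_nonzero by (simp add: nn_operator_def left_diff_distrib sum_subtractf diff_divide_distrib
        flip: sum_distrib_left)
  then have "\<bar>nn_operator logistic a b n f x - f x\<bar> = \<bar>\<Sum>k\<in>?K. (?f k - f x) * ?w k\<bar> / ?D"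
    by (simp only: abs_divide D_abs)
  also have "\<dots> \<le> exp 2 * ?E * ?S / c\<^sup>2"
    using num D c2 E by (intro frac_le) auto
  finally show ?thesis
    by (simp add: mult_ac)
qed

section \<open>Bounds for the Lebesgue norm\<close>

text \<open>After division by \<open>(x + y) powr r\<close> this is \<open>v \<le> v powr r\<close> for the two proportions
  \<open>v \<in> [0, 1]\<close>, which add up to \<open>1\<close>.\<close>

lemma powr_add_le:
  fixes x y r :: real
  assumes "0 \<le> x" "0 \<le> y" "r \<le> 1"
  shows "(x + y) powr r \<le> x powr r + y powr r"
proof (cases "x + y = 0")
  case True
  then show ?thesis
    by simp
next
  case False
  define s where "s = x + y"
  have s: "0 < s"
    using False assms by (simp add: s_def)
  have part: "z / s * s powr r \<le> z powr r" if "0 \<le> z" "z \<le> s" for z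
  proof -
    have "(z / s) powr 1 \<le> (z / s) powr r"
      using that s assms by (intro powr_mono') auto
    then have "z / s \<le> z powr r / s powr r"
      using that s by (simp add: powr_divide)
    then show ?thesis
      using s by (simp add: field_simps)
  qed
  have "s powr r = x / s * s powr r + y / s * s powr r"
    unfolding distrib_right[symmetric] add_divide_distrib[symmetric] s_def[symmetric]
    using s by simp
  also have "\<dots> \<le> x powr r + y powr r"
    using assms by (intro add_mono part) (auto simp: s_def)
  finally show ?thesis
    by (simp add: s_def)
qed

text \<open>The integrand is dominated by a step function, and the two steps are separated by the
  subadditivity of the \<open>p\<close>-th root. If \<open>\<bar>g\<bar> powr p\<close> is not integrable, its integral is \<open>0\<close> by
  convention and the estimate holds trivially.\<close>

lemma Lp_norm_le_exceptional_set:
  assumes p: "1 \<le> p" and B: "B \<in> lmeasurable" and GH: "0 \<le> G" "0 \<le> H"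
    and H: "\<And>x. x \<in> cbox a b \<Longrightarrow> \<bar>g x\<bar> \<le> H"
    and G: "\<And>x. x \<in> cbox a b - B \<Longrightarrow> \<bar>g x\<bar> \<le> G"
  shows "Lp_norm p (cbox a b) g
    \<le> G * measure lebesgue (cbox a b) powr (1 / p) + H * measure lebesgue B powr (1 / p)"
proof -
  let ?h = "\<lambda>x. indicator (cbox a b) x * G powr p + indicator B x * H powr p :: real"
  have int: "integrable lebesgue (indicator S :: _ \<Rightarrow> real)" if "S \<in> lmeasurable" for S :: "(real ^ 2) set"
    using that by (intro integrable_real_indicator) (auto simp: fmeasurable_def less_top)
  have "(LINT x:cbox a b|lebesgue. \<bar>g x\<bar> powr p) \<le> integral\<^sup>L lebesgue ?h"
    unfolding set_lebesgue_integral_def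
  proof (rule integral_mono')
    show "integrable lebesgue ?h"
      using B by (intro Bochner_Integration.integrable_add integrable_mult_left int) auto
    fix x
    show "indicator (cbox a b) x *\<^sub>R \<bar>g x\<bar> powr p \<le> ?h x"
      using H[of x] G[of x] p by (auto simp: indicator_def intro!: powr_mono2 add_increasing)
  qed auto
  also have "\<dots> = measure lebesgue (cbox a b) * G powr p + measure lebesgue B * H powr p"
    using B by (subst Bochner_Integration.integral_add) (auto intro!: integrable_mult_left int)
  finally have "(LINT x:cbox a b|lebesgue. \<bar>g x\<bar> powr p)
    \<le> measure lebesgue (cbox a b) * G powr p + measure lebesgue B * H powr p" .
  then have "Lp_norm p (cbox a b) g
      \<le> (measure lebesgue (cbox a b) * G powr p + measure lebesgue B * H powr p) powr (1 / p)"
    unfolding Lp_norm_def using p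
    by (intro powr_mono2) (auto simp: set_lebesgue_integral_def intro!: Bochner_Integration.integral_nonneg)
  also have "\<dots> \<le> (measure lebesgue (cbox a b) * G powr p) powr (1 / p) + (measure lebesgue B * H powr p) powr (1 / p)"
    using p by (intro powr_add_le) auto
  also have "\<dots> = G * measure lebesgue (cbox a b) powr (1 / p) + H * measure lebesgue B powr (1 / p)"
    using p GH by (simp add: powr_mult powr_powr)
  finally show ?thesis .
qed

text \<open>For the lower bound integrability is essential, since otherwise the right-hand side would be \<open>0\<close>.
  It follows from continuity and boundedness on \<open>U\<close>, and transfers to \<open>S\<close> because Lebesgue
  measurability ignores the values on a null set.\<close>

lemma Lp_norm_ge:
  assumes p: "1 \<le> p" and U: "open U" "bounded U" "negligible (S - U)" and S: "S \<in> lmeasurable"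
    and g: "continuous_on U g" and \<beta>: "0 \<le> \<beta>"
    and bounds: "\<And>x. x \<in> U \<Longrightarrow> \<beta> \<le> \<bar>g x\<bar> powr p \<and> \<bar>g x\<bar> powr p \<le> M"
  shows "(\<beta> * measure lebesgue S) powr (1 / p) \<le> Lp_norm p S g"
proof -
  let ?h = "\<lambda>x. \<bar>g x\<bar> powr p"
  have "?h absolutely_integrable_on U"
  proof (rule measurable_bounded_by_integrable_imp_absolutely_integrable)
    show "?h \<in> borel_measurable (lebesgue_on U)"
      using p g U by (intro continuous_imp_measurable_on_sets_lebesgue continuous_on_powr' continuous_intros) auto
    show "(\<lambda>_. M) integrable_on U"
      using U by (intro integrable_on_const) (auto intro: bounded_set_imp_lmeasurable)
  qed (use U bounds in auto)
  then have "?h absolutely_integrable_on U \<inter> S"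
    by (rule set_integrable_subset) (use S U in \<open>auto intro: fmeasurableD\<close>)
  moreover have "negligible {x \<in> U \<inter> S - S. ?h x \<noteq> 0}" "negligible {x \<in> S - U \<inter> S. ?h x \<noteq> 0}"
    by (auto intro: negligible_subset[OF U(3)])
  ultimately have h: "?h absolutely_integrable_on S"
    using absolutely_integrable_spike_set_eq[of "U \<inter> S" S ?h] by blast
  have const: "set_integrable lebesgue S (\<lambda>_. \<beta>)"
    using S unfolding set_integrable_def real_scaleR_def
    by (intro integrable_mult_left integrable_real_indicator) (auto simp: fmeasurable_def less_top)
  have AE_U: "AE x in lebesgue. x \<notin> S - U"
    using U(3) AE_not_in negligible_iff_null_sets by blast
  have "(LINT x:S|lebesgue. \<beta>) \<le> (LINT x:S|lebesgue. ?h x)"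
    unfolding set_lebesgue_integral_def
  proof (rule integral_mono_AE)
    show "AE x in lebesgue. indicator S x *\<^sub>R \<beta> \<le> indicator S x *\<^sub>R ?h x"
      using AE_U by eventually_elim (use bounds in \<open>auto simp: indicator_def\<close>)
  qed (use const h in \<open>simp_all add: set_integrable_def\<close>)
  moreover have "(LINT x:S|lebesgue. \<beta>) = \<beta> * measure lebesgue S"
    by (simp add: set_lebesgue_integral_def mult.commute)
  ultimately show ?thesis
    unfolding Lp_norm_def using p \<beta> by (intro powr_mono2) auto
qed

section \<open>The grid\<close>

lemma measure_cbox_2:
  fixes c d :: "real ^ 2"
  assumes "c $ 1 \<le> d $ 1" "c $ 2 \<le> d $ 2"
  shows "measure lebesgue (cbox c d) = (d $ 1 - c $ 1) * (d $ 2 - c $ 2)"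
proof -
  have "cbox c d \<noteq> {}"
    using assms by (simp add: interval_ne_empty_cart forall_2)
  then show ?thesis
    by (simp add: content_cbox_cart UNIV_2)
qed

text \<open>The set \<open>W\<close> is the union of the slabs of width \<open>2 * \<delta>\<close> around the grid lines. What matters is
  that its measure is linear in \<open>\<delta>\<close>, with a factor that depends on the grid alone.\<close>

lemma grid_neighbourhood:
  fixes a b :: "real ^ 2" and l t :: "nat \<Rightarrow> real"
  assumes "0 \<le> \<delta>" and "a $ 1 \<le> b $ 1" "a $ 2 \<le> b $ 2"
  shows "\<exists>W\<in>lmeasurable.
    measure lebesgue W \<le> 2 * (real (Suc q1) * (b $ 2 - a $ 2) + real (Suc q2) * (b $ 1 - a $ 1)) * \<delta> \<and>
    (\<forall>x\<in>cbox a b - W. (\<forall>i\<le>q1. \<delta> < \<bar>x $ 1 - l i\<bar>) \<and> (\<forall>j\<le>q2. \<delta> < \<bar>x $ 2 - t j\<bar>))"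
proof -
  define V where "V i = cbox (vector [l i - \<delta>, a $ 2]) (vector [l i + \<delta>, b $ 2] :: real ^ 2)" for i
  define H where "H j = cbox (vector [a $ 1, t j - \<delta>]) (vector [b $ 1, t j + \<delta>] :: real ^ 2)" for j
  define W where "W = (\<Union>i\<le>q1. V i) \<union> (\<Union>j\<le>q2. H j)"
  have V: "measure lebesgue (V i) = 2 * \<delta> * (b $ 2 - a $ 2)" for i
    unfolding V_def using assms by (subst measure_cbox_2) auto
  have H: "measure lebesgue (H j) = (b $ 1 - a $ 1) * (2 * \<delta>)" for j
    unfolding H_def using assms by (subst measure_cbox_2) auto
  have W: "W \<in> lmeasurable"
    unfolding W_def V_def H_def by (intro fmeasurable.Un fmeasurable.finite_UN) auto
  have "measure lebesgue W \<le> measure lebesgue (\<Union>i\<le>q1. V i) + measure lebesgue (\<Union>j\<le>q2. H j)"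
    unfolding W_def by (intro measure_Un_le) (auto simp: V_def H_def)
  also have "\<dots> \<le> (\<Sum>i\<le>q1. measure lebesgue (V i)) + (\<Sum>j\<le>q2. measure lebesgue (H j))"
    by (intro add_mono measure_UNION_le) (auto simp: V_def H_def)
  also have "\<dots> = 2 * (real (Suc q1) * (b $ 2 - a $ 2) + real (Suc q2) * (b $ 1 - a $ 1)) * \<delta>"
    unfolding V H by (simp add: algebra_simps)
  finally have "measure lebesgue W \<le> 2 * (real (Suc q1) * (b $ 2 - a $ 2) + real (Suc q2) * (b $ 1 - a $ 1)) * \<delta>" .
  moreover have "\<delta> < \<bar>x $ 1 - l i\<bar>" if "x \<in> cbox a b - W" "i \<le> q1" for x i
  proof (rule ccontr)
    assume "\<not> ?thesis"
    then have "x \<in> V i"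
      using that by (auto simp: V_def mem_box_cart forall_2 abs_le_iff)
    then show False
      using that by (auto simp: W_def)
  qed
  moreover have "\<delta> < \<bar>x $ 2 - t j\<bar>" if "x \<in> cbox a b - W" "j \<le> q2" for x j
  proof (rule ccontr)
    assume "\<not> ?thesis"
    then have "x \<in> H j"
      using that by (auto simp: H_def mem_box_cart forall_2 abs_le_iff)
    then show False
      using that by (auto simp: W_def)
  qed
  ultimately show ?thesis
    using W by blast
qed

lemma subdivision_less:
  assumes "is_subdivision q l \<alpha> \<omega>"
  shows "\<alpha> < \<omega>"
proof -
  have "k \<le> q \<Longrightarrow> 0 < k \<Longrightarrow> l 0 < l k" for k
  proof (induction k)
    case (Suc k)
    then have "l k < l (Suc k)"
      using assms by (simp add: is_subdivision_def)
    with Suc show ?case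
      by (cases "k = 0") auto
  qed simp
  from this[of q] show ?thesis
    using assms by (auto simp: is_subdivision_def)
qed

text \<open>Take the first subdivision point beyond \<open>u\<close>.\<close>

lemma subdivision_between:
  assumes "is_subdivision q l \<alpha> \<omega>" "\<alpha> \<le> u" "u \<le> \<omega>" "\<And>i. i \<le> q \<Longrightarrow> u \<noteq> l i"
  shows "\<exists>i<q. l i < u \<and> u < l (Suc i)"
proof -
  have "k \<le> q \<Longrightarrow> u < l k \<Longrightarrow> \<exists>i<k. l i < u \<and> u < l (Suc i)" for k
  proof (induction k)
    case 0
    then show ?case
      using assms by (simp add: is_subdivision_def)
  next
    case (Suc k)
    show ?case
    proof (cases "u < l k")
      case True
      then show ?thesis
        using Suc less_SucI by (metis Suc_leD)
    next
      case False
      then have "l k < u"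
        using assms(4)[of k] Suc.prems by simp
      then show ?thesis
        using Suc.prems by blast
    qed
  qed
  moreover have "u < l q"
    using assms(1,3) assms(4)[of q] by (simp add: is_subdivision_def)
  ultimately show ?thesis
    by blast
qed

text \<open>Only points strictly between grid lines are used, so that membership is four strict
  inequalities whether or not the cell touches the right or upper edge of the rectangle.\<close>

definition open_cell :: "(nat \<Rightarrow> real) \<Rightarrow> (nat \<Rightarrow> real) \<Rightarrow> nat \<Rightarrow> nat \<Rightarrow> (real ^ 2) set" where
  "open_cell l t i j = {x. l i < x $ 1 \<and> x $ 1 < l (Suc i) \<and> t j < x $ 2 \<and> x $ 2 < t (Suc j)}"

lemma open_open_cell: "open (open_cell l t i j)"
  unfolding open_cell_def
  by (intro open_Collect_conj open_Collect_less continuous_intros)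

lemma open_cell_subset_interior_cell: "open_cell l t i j \<subseteq> interior (cell q1 l q2 t i j)"
  by (rule interior_maximal[OF _ open_open_cell])
    (auto simp: open_cell_def cell_def subdivision_interval_def)

text \<open>The derivative that defines \<open>partial_deriv\<close> at the point \<open>x + s *\<^sub>R axis m 1\<close> is taken at \<open>0\<close>; shifting
  it to \<open>s\<close> makes the one-dimensional mean value theorem applicable along the segment.\<close>

lemma abs_diff_axis_le:
  assumes "\<And>s. s \<in> closed_segment 0 d \<Longrightarrow>
      (\<lambda>r. f (x + s *\<^sub>R axis m 1 + r *\<^sub>R axis m 1)) differentiable (at 0)"
    and "\<And>s. s \<in> closed_segment 0 d \<Longrightarrow> \<bar>partial_deriv m f (x + s *\<^sub>R axis m 1)\<bar> \<le> L"
  shows "\<bar>f (x + d *\<^sub>R axis m 1) - f x\<bar> \<le> L * \<bar>d\<bar>"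
proof -
  let ?g = "\<lambda>s. f (x + s *\<^sub>R axis m 1)"
  have "norm (?g d - ?g 0) \<le> L * norm (d - 0)"
  proof (rule field_differentiable_bound)
    fix s
    assume s: "s \<in> closed_segment 0 d"
    have "((\<lambda>r. f (x + s *\<^sub>R axis m 1 + r *\<^sub>R axis m 1)) has_real_derivative
        partial_deriv m f (x + s *\<^sub>R axis m 1)) (at 0)"
      using assms(1)[OF s] unfolding partial_deriv_def by (simp add: DERIV_deriv_iff_real_differentiable)
    then have "((\<lambda>r. ?g (r + s)) has_real_derivative partial_deriv m f (x + s *\<^sub>R axis m 1)) (at 0)"
      by (simp add: algebra_simps)
    then have "(?g has_real_derivative partial_deriv m f (x + s *\<^sub>R axis m 1)) (at (0 + s))"
      by (simp only: DERIV_shift)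
    then show "(?g has_real_derivative partial_deriv m f (x + s *\<^sub>R axis m 1)) (at s within closed_segment 0 d)"
      by (simp add: has_field_derivative_at_within)
  qed (use assms(2) in auto)
  then show ?thesis
    by simp
qed

text \<open>Go from \<open>x\<close> to \<open>y\<close> in two steps parallel to the axes; the corner \<open>w\<close> lies in the cell because the
  cell is a product of intervals.\<close>

lemma lipschitz_on_open_cell:
  assumes diff: "\<And>m x. x \<in> open_cell l t i j \<Longrightarrow> (\<lambda>s. f (x + s *\<^sub>R axis m 1)) differentiable (at 0)"
    and bound: "\<And>m x. x \<in> open_cell l t i j \<Longrightarrow> \<bar>partial_deriv m f x\<bar> \<le> L"
    and xy: "x \<in> open_cell l t i j" "y \<in> open_cell l t i j"
  shows "\<bar>f y - f x\<bar> \<le> L * (\<bar>y $ 1 - x $ 1\<bar> + \<bar>y $ 2 - x $ 2\<bar>)"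
proof -
  define w where "w = x + (y $ 1 - x $ 1) *\<^sub>R axis 1 1"
  have w: "w $ 1 = y $ 1" "w $ 2 = x $ 2"
    by (simp_all add: w_def axis_def)
  have y: "y = w + (y $ 2 - x $ 2) *\<^sub>R axis 2 1"
    using w by (simp add: vec_eq_iff forall_2 axis_def)
  have "x + s *\<^sub>R axis 1 1 \<in> open_cell l t i j" if "s \<in> closed_segment 0 (y $ 1 - x $ 1)" for s
    using that xy by (auto simp: open_cell_def axis_def closed_segment_eq_real_ivl split: if_splits)
  then have "\<bar>f w - f x\<bar> \<le> L * \<bar>y $ 1 - x $ 1\<bar>"
    unfolding w_def by (intro abs_diff_axis_le diff bound)
  moreover have "w + s *\<^sub>R axis 2 1 \<in> open_cell l t i j" if "s \<in> closed_segment 0 (y $ 2 - x $ 2)" for s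
    using that xy w by (auto simp: open_cell_def axis_def closed_segment_eq_real_ivl split: if_splits)
  then have "\<bar>f (w + (y $ 2 - x $ 2) *\<^sub>R axis 2 1) - f w\<bar> \<le> L * \<bar>y $ 2 - x $ 2\<bar>"
    by (intro abs_diff_axis_le diff bound)
  ultimately show ?thesis
    unfolding y[symmetric] distrib_left by linarith
qed

lemma negligible_off_open_cells:
  assumes "is_subdivision q1 l (a $ 1) (b $ 1)" "is_subdivision q2 t (a $ 2) (b $ 2)"
  shows "negligible (cbox a b - (\<Union>i<q1. \<Union>j<q2. open_cell l t i j))"
proof (rule negligible_subset)
  have hyperplane: "negligible {x :: real ^ 2. x $ m = c}" for m c
    using negligible_hyperplane[of "axis m 1 :: real ^ 2" c]
    by (simp add: inner_axis' axis_eq_0_iff)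
  show "negligible ((\<Union>i\<le>q1. {x :: real ^ 2. x $ 1 = l i}) \<union> (\<Union>j\<le>q2. {x. x $ 2 = t j}))"
    by (intro negligible_Un negligible_Union) (auto intro: hyperplane)
  show "cbox a b - (\<Union>i<q1. \<Union>j<q2. open_cell l t i j)
      \<subseteq> (\<Union>i\<le>q1. {x. x $ 1 = l i}) \<union> (\<Union>j\<le>q2. {x. x $ 2 = t j})"
  proof (rule subsetI, rule ccontr)
    fix x
    assume x: "x \<in> cbox a b - (\<Union>i<q1. \<Union>j<q2. open_cell l t i j)"
      and off: "x \<notin> (\<Union>i\<le>q1. {x. x $ 1 = l i}) \<union> (\<Union>j\<le>q2. {x. x $ 2 = t j})"
    have "\<exists>i<q1. l i < x $ 1 \<and> x $ 1 < l (Suc i)"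
      using assms(1) by (rule subdivision_between) (use x off in \<open>auto simp: mem_box_cart\<close>)
    moreover have "\<exists>j<q2. t j < x $ 2 \<and> x $ 2 < t (Suc j)"
      using assms(2) by (rule subdivision_between) (use x off in \<open>auto simp: mem_box_cart\<close>)
    ultimately show False
      using x by (auto simp: open_cell_def)
  qed
qed

section \<open>Combining the estimates\<close>

lemma W1p_norm_ge_Lp_norm_partial: "Lp_norm p S (partial_deriv m f) \<le> W1p_norm p S f"
proof -
  have "Lp_norm p S (partial_deriv m f) \<le> (\<Sum>m\<in>UNIV. Lp_norm p S (partial_deriv m f))"
    by (intro member_le_sum) (auto simp: Lp_norm_def)
  moreover have "0 \<le> Lp_norm p S f"
    by (simp add: Lp_norm_def)
  ultimately show ?thesis
    by (simp add: W1p_norm_def)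
qed

text \<open>Since \<open>\<theta> < \<eta> < 1\<close>, both terms on the left are of smaller order than \<open>n powr (- \<theta> / p)\<close>, and
  a large \<open>n\<close> absorbs any \<open>C\<close> and \<open>D\<close>. This gap between the exponents is what permits a
  constant as specific as \<open>8\<close>.\<close>

lemma eventually_remainder_le:
  fixes p \<theta> \<eta> C D :: real
  assumes "1 \<le> p" "\<theta> < \<eta>" "\<eta> < 1"
  shows "eventually (\<lambda>n. D * exp (- (real n powr (1 - \<eta>)) / 2) + C * (real n powr (- \<eta>)) powr (1 / p)
    \<le> 8 powr (1 / p) / real n powr (\<theta> / p)) sequentially"
proof -
  define s where "s = 1 - \<eta>"
  define u where "u = \<theta> / p"
  define v where "v = (\<theta> - \<eta>) / p"
  have s: "0 < s" and v: "v < 0"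
    using assms by (simp_all add: s_def v_def field_simps)
  have "(\<lambda>n. exp (- (real n powr s) / 2) * real n powr u) \<longlonglongrightarrow> 0"
    using s by real_asymp
  moreover have "(\<lambda>n. real n powr v) \<longlonglongrightarrow> 0"
    using v by real_asymp
  ultimately have "(\<lambda>n. D * (exp (- (real n powr s) / 2) * real n powr u) + C * real n powr v) \<longlonglongrightarrow> D * 0 + C * 0"
    by (intro tendsto_intros)
  then have "eventually (\<lambda>n. D * (exp (- (real n powr s) / 2) * real n powr u) + C * real n powr v < 8 powr (1 / p)) sequentially"
    by (rule order_tendstoD) simp
  then show ?thesis
    using eventually_gt_at_top[of 0]
  proof eventually_elim
    case (elim n)
    have "(real n powr (- \<eta>)) powr (1 / p) * real n powr u = real n powr v"
      using elim by (simp add: powr_powr u_def v_def diff_divide_distrib flip: powr_add)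
    then show ?case
      using elim by (simp add: pos_le_divide_eq s_def u_def distrib_right mult.assoc)
  qed
qed

text \<open>A node within distance \<open>\<delta>\<close> of \<open>x\<close> lies in the same open cell as \<open>x\<close>, so there the Lipschitz
  bound applies. Every other node has distance at least \<open>n * \<delta>\<close> after scaling, and the trivial bound
  \<open>2 * F\<close> is damped by the decay of the weights.\<close>

lemma nn_operator_error_off_grid:
  fixes f :: "real ^ 2 \<Rightarrow> real"
  assumes n: "0 < n" and x: "x \<in> cbox a b" and wide: "\<And>i. 1 \<le> real n * (b $ i - a $ i)"
    and c: "0 < c" "\<And>u. \<bar>u\<bar> \<le> 1 \<Longrightarrow> c \<le> phi logistic u"
    and l: "is_subdivision q1 l (a $ 1) (b $ 1)" and t: "is_subdivision q2 t (a $ 2) (b $ 2)"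
    and diff: "\<And>i j m y. i < q1 \<Longrightarrow> j < q2 \<Longrightarrow> y \<in> open_cell l t i j \<Longrightarrow>
      (\<lambda>s. f (y + s *\<^sub>R axis m 1)) differentiable (at 0)"
    and deriv: "\<And>i j m y. i < q1 \<Longrightarrow> j < q2 \<Longrightarrow> y \<in> open_cell l t i j \<Longrightarrow> \<bar>partial_deriv m f y\<bar> \<le> L"
    and F: "\<And>y. y \<in> cbox a b \<Longrightarrow> \<bar>f y\<bar> \<le> F"
    and L: "0 \<le> L" and \<delta>: "0 \<le> \<delta>"
    and off: "\<And>i. i \<le> q1 \<Longrightarrow> \<delta> < \<bar>x $ 1 - l i\<bar>" "\<And>j. j \<le> q2 \<Longrightarrow> \<delta> < \<bar>x $ 2 - t j\<bar>"
  shows "\<bar>nn_operator logistic a b n f x - f x\<bar>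
    \<le> exp 2 * (2 * exp (1/2) / (1 - exp (- 1/2)))\<^sup>2 / c\<^sup>2
        * (2 * (L / real n) + 2 * F * exp (- (real n * \<delta>) / 2))"
proof (rule nn_operator_error_le[OF n x wide c])
  obtain i where i: "i < q1" "l i < x $ 1" "x $ 1 < l (Suc i)"
    using subdivision_between[OF l, of "x $ 1"] off(1) \<delta> x by (fastforce simp: mem_box_cart)
  obtain j where j: "j < q2" "t j < x $ 2" "x $ 2 < t (Suc j)"
    using subdivision_between[OF t, of "x $ 2"] off(2) \<delta> x by (fastforce simp: mem_box_cart)
  have x_cell: "x \<in> open_cell l t i j"
    using i j by (simp add: open_cell_def)
  have margin: "l i + \<delta> < x $ 1" "x $ 1 + \<delta> < l (Suc i)" "t j + \<delta> < x $ 2" "x $ 2 + \<delta> < t (Suc j)"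
    using off(1)[of i] off(1)[of "Suc i"] off(2)[of j] off(2)[of "Suc j"] i j by auto
  show "0 \<le> L / real n"
    using L by simp
  have "0 \<le> F"
    using F[OF x] by linarith
  then show "0 \<le> 2 * F"
    by simp
  fix k
  assume k: "k \<in> node_indices a b n"
  define y where "y = (\<chi> i. real_of_int (k $ i) / real n)"
  have dist: "node_dist n x k = real n * (\<bar>y $ 1 - x $ 1\<bar> + \<bar>y $ 2 - x $ 2\<bar>)"
  proof -
    have "real n * x $ m - real_of_int (k $ m) = - (real n * (y $ m - x $ m))" for m
      using n by (simp add: y_def field_simps)
    then show ?thesis
      using n by (simp add: node_dist_def abs_mult distrib_left)
  qed
  have "\<bar>f y - f x\<bar> \<le> L / real n * node_dist n x k + (if node_dist n x k < real n * \<delta> then 0 else 2 * F)"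
  proof (cases "node_dist n x k < real n * \<delta>")
    case True
    then have "\<bar>y $ 1 - x $ 1\<bar> + \<bar>y $ 2 - x $ 2\<bar> < \<delta>"
      using n by (simp add: dist)
    then have "y \<in> open_cell l t i j"
      using margin unfolding open_cell_def by auto
    then have "\<bar>f y - f x\<bar> \<le> L * (\<bar>y $ 1 - x $ 1\<bar> + \<bar>y $ 2 - x $ 2\<bar>)"
      using i j x_cell by (intro lipschitz_on_open_cell[of l t i j] diff deriv)
    then show ?thesis
      using True n by (simp add: dist)
  next
    case False
    have "y \<in> cbox a b"
      unfolding y_def using n k by (rule node_in_cbox)
    then have "\<bar>f y - f x\<bar> \<le> 2 * F"
      using F[of y] F[OF x] by linarith
    moreover have "0 \<le> L / real n * node_dist n x k"
      using L by (simp add: node_dist_def)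
    ultimately show ?thesis
      using False by simp
  qed
  then show "\<bar>f (\<chi> i. real_of_int (k $ i) / real n) - f x\<bar>
      \<le> L / real n * node_dist n x k + (if node_dist n x k < real n * \<delta> then 0 else 2 * F)"
    by (simp only: y_def)
qed

text \<open>This is where the lower bound on the derivatives enters: it makes the Sobolev norm at least a
  multiple of \<open>\<beta> powr (1 / p)\<close>, so that a Lipschitz constant \<open>M powr (1 / p)\<close> can be traded for
  \<open>M powr (1 / p) / \<beta> powr (1 / p)\<close> times the norm of \<open>f\<close>.\<close>

lemma W1p_norm_ge:
  assumes p: "1 \<le> p" and \<beta>: "0 \<le> \<beta>"
    and l: "is_subdivision q1 l (a $ 1) (b $ 1)" and t: "is_subdivision q2 t (a $ 2) (b $ 2)"
    and cont: "\<And>i j. i < q1 \<Longrightarrow> j < q2 \<Longrightarrow> continuous_on (open_cell l t i j) (partial_deriv m f)"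
    and bounds: "\<And>i j x. i < q1 \<Longrightarrow> j < q2 \<Longrightarrow> x \<in> open_cell l t i j \<Longrightarrow>
      \<beta> \<le> \<bar>partial_deriv m f x\<bar> powr p \<and> \<bar>partial_deriv m f x\<bar> powr p \<le> M"
  shows "(\<beta> * measure lebesgue (cbox a b)) powr (1 / p) \<le> W1p_norm p (cbox a b) f"
proof -
  let ?U = "\<Union>i<q1. \<Union>j<q2. open_cell l t i j"
  \<comment> \<open>Intersecting with the open rectangle gives boundedness at once and changes the
      union by a null set only.\<close>
  let ?V = "box a b \<inter> ?U"
  have "cbox a b - ?V \<subseteq> (cbox a b - box a b) \<union> (cbox a b - ?U)"
    by blast
  then have "negligible (cbox a b - ?V)"
    using negligible_frontier_interval negligible_off_open_cells[OF l t] negligible_Un negligible_subset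
    by metis
  moreover have "continuous_on ?U (partial_deriv m f)"
    using cont by (intro continuous_on_open_UN open_UN) (auto intro: open_open_cell)
  then have "continuous_on ?V (partial_deriv m f)"
    by (rule continuous_on_subset) blast
  moreover have "open ?V"
    by (intro open_Int open_UN open_box) (auto intro: open_open_cell)
  moreover have "bounded ?V"
    by (simp add: bounded_Int)
  ultimately have "(\<beta> * measure lebesgue (cbox a b)) powr (1 / p) \<le> Lp_norm p (cbox a b) (partial_deriv m f)"
    using p \<beta> bounds by (intro Lp_norm_ge[of p ?V "cbox a b" _ \<beta> M]) auto
  then show ?thesis
    using W1p_norm_ge_Lp_norm_partial order_trans by blast
qed

theorem corollary10:
  fixes p \<theta> :: real
    and a b :: "real ^ 2"
    and q1 q2 :: nat
    and l t :: "nat \<Rightarrow> real"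
  assumes "1 \<le> p"
    and "0 < \<theta>" and "\<theta> < 1"
    and "is_subdivision q1 l (a $ 1) (b $ 1)"
    and "is_subdivision q2 t (a $ 2) (b $ 2)"
  shows "\<exists>K1 K2. 0 < K1 \<and> 0 < K2 \<and>
    (\<forall>(f :: real ^ 2 \<Rightarrow> real) M \<beta>.
       bounded (f ` cbox a b) \<longrightarrow>
       (\<forall>i<q1. \<forall>j<q2. C1_on (interior (cell q1 l q2 t i j)) f) \<longrightarrow>
       0 < M \<longrightarrow> 0 < \<beta> \<longrightarrow>
       (\<forall>i<q1. \<forall>j<q2. \<forall>m. \<forall>x\<in>interior (cell q1 l q2 t i j).
          \<beta> \<le> \<bar>partial_deriv m f x\<bar> powr p \<and> \<bar>partial_deriv m f x\<bar> powr p \<le> M) \<longrightarrow>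
       (\<forall>n\<ge>1.
          Lp_norm p (cbox a b) (\<lambda>x. nn_operator logistic a b n f x - f x)
          \<le> (2 powr (p - 1) * real q1 * real q2) powr (1 / p) *
             (M powr (1 / p) / \<beta> powr (1 / p) * (K1 / real n) * W1p_norm p (cbox a b) f
              + 8 powr (1 / p) * (sup_norm (cbox a b) f / real n powr (\<theta> / p))
              + K2 * sup_norm (cbox a b) f * exp (- (real n powr (1 - \<theta>)) / p))))"
proof -
  note p = assms(1) and l = assms(4) and t = assms(5)
  have side: "a $ 1 < b $ 1" "a $ 2 < b $ 2"
    using subdivision_less[OF l] subdivision_less[OF t] .
  obtain c where c: "0 < c" "\<And>u. \<bar>u\<bar> \<le> 1 \<Longrightarrow> c \<le> phi logistic u"
    using phi_logistic_bounded_below by blast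
  define C where "C = exp 2 * (2 * exp (1/2) / (1 - exp (- 1/2)))\<^sup>2 / c\<^sup>2"
  have C: "0 < C"
    using c by (simp add: C_def)
  \<comment> \<open>Any exponent strictly between \<open>\<theta>\<close> and \<open>1\<close> serves for the width \<open>n powr (- \<eta>)\<close> of the strips.\<close>
  define \<eta> where "\<eta> = (1 + \<theta>) / 2"
  have \<eta>: "\<theta> < \<eta>" "\<eta> < 1"
    using assms(3) by (simp_all add: \<eta>_def)
  define A where "A = measure lebesgue (cbox a b) powr (1 / p)"
  have A: "0 < A"
    unfolding A_def using side by (subst measure_cbox_2) auto
  define D where "D = 2 * (real (Suc q1) * (b $ 2 - a $ 2) + real (Suc q2) * (b $ 1 - a $ 1))"
  have D: "0 \<le> D"
    using side by (simp add: D_def)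
  have "eventually (\<lambda>n. 1 \<le> real n * w) sequentially" if "0 < w" for w
    using that by real_asymp
  then have "eventually (\<lambda>n. \<forall>i. 1 \<le> real n * (b $ i - a $ i)) sequentially"
    using side unfolding forall_2 by (intro eventually_conj) auto
  then have "eventually (\<lambda>n.
      2 * C * A * exp (- (real n powr (1 - \<eta>)) / 2) + 2 * D powr (1 / p) * (real n powr (- \<eta>)) powr (1 / p)
        \<le> 8 powr (1 / p) / real n powr (\<theta> / p) \<and> (\<forall>i. 1 \<le> real n * (b $ i - a $ i))) sequentially"
    by (intro eventually_conj eventually_remainder_le p \<eta>)
  then obtain N where N:
      "\<And>n. N \<le> n \<Longrightarrow> 2 * C * A * exp (- (real n powr (1 - \<eta>)) / 2)
          + 2 * D powr (1 / p) * (real n powr (- \<eta>)) powr (1 / p) \<le> 8 powr (1 / p) / real n powr (\<theta> / p)"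
      "\<And>n i. N \<le> n \<Longrightarrow> 1 \<le> real n * (b $ i - a $ i)"
    unfolding eventually_sequentially by blast
  \<comment> \<open>Chosen for the finitely many \<open>n < N\<close>: there \<open>K2 * exp (- (n powr (1 - \<theta>)) / p)\<close> is at least
      \<open>2 * A\<close>, which settles them by the trivial bound \<open>2 * F\<close> on the error.\<close>
  define K2 where "K2 = 2 * A * exp (real N powr (1 - \<theta>) / p)"
  have K2: "0 < K2"
    using A by (simp add: K2_def)
  have "Lp_norm p (cbox a b) (\<lambda>x. nn_operator logistic a b n f x - f x)
      \<le> (2 powr (p - 1) * real q1 * real q2) powr (1 / p) *
         (M powr (1 / p) / \<beta> powr (1 / p) * (2 * C / real n) * W1p_norm p (cbox a b) f
          + 8 powr (1 / p) * (sup_norm (cbox a b) f / real n powr (\<theta> / p))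
          + K2 * sup_norm (cbox a b) f * exp (- (real n powr (1 - \<theta>)) / p))"
    if bdd: "bounded (f ` cbox a b)"
      and C1: "\<forall>i<q1. \<forall>j<q2. C1_on (interior (cell q1 l q2 t i j)) f"
      and M: "0 < M" and \<beta>: "0 < \<beta>"
      and bounds: "\<forall>i<q1. \<forall>j<q2. \<forall>m. \<forall>x\<in>interior (cell q1 l q2 t i j).
          \<beta> \<le> \<bar>partial_deriv m f x\<bar> powr p \<and> \<bar>partial_deriv m f x\<bar> powr p \<le> M"
      and n: "1 \<le> n"
    for f :: "real ^ 2 \<Rightarrow> real" and M \<beta> n
  proof -
    let ?E = "\<lambda>x. nn_operator logistic a b n f x - f x"
    define F where "F = sup_norm (cbox a b) f"
    define W where "W = W1p_norm p (cbox a b) f"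
    define L where "L = M powr (1 / p)"
    have n0: "0 < n"
      using n by simp
    have "bdd_above ((\<lambda>x. \<bar>f x\<bar>) ` cbox a b)"
      using bdd by (auto simp: bounded_iff bdd_above_def)
    then have F: "\<bar>f y\<bar> \<le> F" if "y \<in> cbox a b" for y
      unfolding F_def sup_norm_def using that by (intro cSUP_upper)
    have "a \<in> cbox a b"
      using side by (simp add: mem_box_cart forall_2)
    then have F0: "0 \<le> F"
      using F by fastforce
    have W0: "0 \<le> W"
      by (simp add: W_def W1p_norm_def Lp_norm_def sum_nonneg)
    have E_le: "\<bar>?E x\<bar> \<le> 2 * F" if "x \<in> cbox a b" for x
      using abs_nn_operator_le[of n a b f F x, OF n0 F F0] F[OF that] by linarith
    have "Lp_norm p (cbox a b) ?E
        \<le> M powr (1 / p) / \<beta> powr (1 / p) * (2 * C / real n) * W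
          + 8 powr (1 / p) * (F / real n powr (\<theta> / p))
          + K2 * F * exp (- (real n powr (1 - \<theta>)) / p)"
      (is "_ \<le> ?T1 + ?T2 + ?T3")
    proof (cases "n < N")
      case True
      have "Lp_norm p (cbox a b) ?E \<le> 2 * F * A"
        using Lp_norm_le_exceptional_set[of p "{}" "2 * F" "2 * F" a b ?E] p F0 E_le by (simp add: A_def)
      also have "\<dots> = 2 * F * A * 1"
        by simp
      also have "\<dots> \<le> 2 * F * A * exp ((real N powr (1 - \<theta>) - real n powr (1 - \<theta>)) / p)"
        using True assms(3) F0 A p by (intro mult_left_mono) (auto intro!: powr_mono2 divide_nonneg_pos)
      also have "\<dots> = ?T3"
        by (simp add: K2_def diff_divide_distrib flip: exp_add)
      also have "\<dots> \<le> ?T1 + ?T2 + ?T3"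
        using C W0 F0 by simp
      finally show ?thesis .
    next
      case False
      have inner: "x \<in> interior (cell q1 l q2 t i j)" if "x \<in> open_cell l t i j" for x i j
        using that open_cell_subset_interior_cell by blast
      have diff: "(\<lambda>s. f (y + s *\<^sub>R axis m 1)) differentiable (at 0)"
        if "i < q1" "j < q2" "y \<in> open_cell l t i j" for i j m y
        using C1 inner that unfolding C1_on_def by blast
      have deriv: "\<bar>partial_deriv m f y\<bar> \<le> L"
        if "i < q1" "j < q2" "y \<in> open_cell l t i j" for i j m y
      proof -
        have "\<bar>partial_deriv m f y\<bar> powr p \<le> M"
          using bounds inner that by blast
        then have "(\<bar>partial_deriv m f y\<bar> powr p) powr (1 / p) \<le> L"
          unfolding L_def using p by (intro powr_mono2) auto
        then show ?thesis
          using p by (simp add: powr_powr)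
      qed
      define \<delta> where "\<delta> = real n powr (- \<eta>)"
      have n\<delta>: "real n * \<delta> = real n powr (1 - \<eta>)"
        using n0 powr_add[of "real n" 1 "- \<eta>"] by (simp add: \<delta>_def)
      define G where "G = C * (2 * (L / real n) + 2 * F * exp (- (real n powr (1 - \<eta>)) / 2))"
      have G0: "0 \<le> G"
        using C F0 by (simp add: G_def L_def)
      obtain B where B: "B \<in> lmeasurable" "measure lebesgue B \<le> D * \<delta>"
        and off: "\<And>x i. x \<in> cbox a b - B \<Longrightarrow> i \<le> q1 \<Longrightarrow> \<delta> < \<bar>x $ 1 - l i\<bar>"
          "\<And>x j. x \<in> cbox a b - B \<Longrightarrow> j \<le> q2 \<Longrightarrow> \<delta> < \<bar>x $ 2 - t j\<bar>"
        using grid_neighbourhood[of \<delta> a b q1 q2 l t] side unfolding D_def[symmetric]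
        by (auto simp: \<delta>_def)
      have "\<bar>?E x\<bar> \<le> G" if "x \<in> cbox a b - B" for x
        unfolding G_def C_def n\<delta>[symmetric]
        by (rule nn_operator_error_off_grid[OF n0 _ _ c l t])
          (use that False N(2) diff deriv F off in \<open>auto simp: L_def \<delta>_def\<close>)
      then have "Lp_norm p (cbox a b) ?E \<le> G * A + 2 * F * measure lebesgue B powr (1 / p)"
        unfolding A_def using p B G0 F0 E_le by (intro Lp_norm_le_exceptional_set) auto
      also have "2 * F * measure lebesgue B powr (1 / p) \<le> 2 * F * (D * \<delta>) powr (1 / p)"
        using B F0 p by (intro mult_left_mono powr_mono2) auto
      also have "G * A + 2 * F * (D * \<delta>) powr (1 / p)
          = A * L * (2 * C / real n)
            + F * (2 * C * A * exp (- (real n powr (1 - \<eta>)) / 2) + 2 * D powr (1 / p) * \<delta> powr (1 / p))"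
        using D by (simp add: G_def \<delta>_def powr_mult algebra_simps)
      also have "\<dots> \<le> ?T1 + F * (8 powr (1 / p) / real n powr (\<theta> / p))"
      proof (rule add_mono)
        have cont: "continuous_on (open_cell l t i j) (partial_deriv m f)" if "i < q1" "j < q2" for i j m
          using C1 that open_cell_subset_interior_cell unfolding C1_on_def
          by (meson continuous_on_subset)
        have "(\<beta> * measure lebesgue (cbox a b)) powr (1 / p) \<le> W"
          unfolding W_def using p \<beta> bounds inner
          by (intro W1p_norm_ge[OF _ _ l t cont, where m = 1 and M = M]) auto
        then have "\<beta> powr (1 / p) * A \<le> W"
          using \<beta> by (simp add: A_def powr_mult)
        then have "A \<le> W / \<beta> powr (1 / p)"
          using \<beta> by (simp add: field_simps)
        then have "A * (L * (2 * C / real n)) \<le> W / \<beta> powr (1 / p) * (L * (2 * C / real n))"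
          using C by (intro mult_right_mono) (auto simp: L_def)
        then show "A * L * (2 * C / real n) \<le> ?T1"
          by (simp add: L_def mult_ac)
        show "F * (2 * C * A * exp (- (real n powr (1 - \<eta>)) / 2) + 2 * D powr (1 / p) * \<delta> powr (1 / p))
            \<le> F * (8 powr (1 / p) / real n powr (\<theta> / p))"
          unfolding \<delta>_def using N(1)[of n] False F0 by (intro mult_left_mono) auto
      qed
      also have "\<dots> \<le> ?T1 + ?T2 + ?T3"
        using K2 F0 by (simp add: mult_ac)
      finally show ?thesis
        by simp
    qed
    also have "\<dots> \<le> (2 powr (p - 1) * real q1 * real q2) powr (1 / p) * (?T1 + ?T2 + ?T3)"
    proof -
      have "1 \<le> real q1" "1 \<le> real q2"
        using l t by (auto simp: is_subdivision_def)
      then have "1 * 1 * 1 \<le> 2 powr (p - 1) * real q1 * real q2"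
        using p by (intro mult_mono) (auto intro: ge_one_powr_ge_zero)
      then have "1 \<le> (2 powr (p - 1) * real q1 * real q2) powr (1 / p)"
        using p by (intro ge_one_powr_ge_zero) auto
      moreover have "0 \<le> ?T1 + ?T2 + ?T3"
        using C W0 F0 K2 by simp
      ultimately show ?thesis
        by (simp add: mult_le_cancel_right1)
    qed
    finally show ?thesis
      unfolding F_def W_def .
  qed
  then show ?thesis
    using C K2 by (intro exI[of _ "2 * C"] exI[of _ K2]) auto
qed

end
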